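(* The order type of the eventual dominance order $\preceq$ on the one-variable $\{+,!\}$-term functions is precisely $\epsilon_0$, and the order type of $\preceq$ on the one-variable $\{+,\exp_2\}$-term functions is precisely $\epsilon_0$.
   Context: $\mathbb{N}=\{1,2,\dots\}$. The one-variable $\{+,!\}$-term functions are the functions $\mathbb{N}\to\mathbb{N}$ in the smallest set containing the identity function $x$ and closed under pointwise addition and $f\mapsto f!$ (factorial); the one-variable $\{+,\exp_2\}$-term functions are defined in the same way with $f\mapsto \exp_2(f)=2^{f}$ in place of factorial. There are no constants in these signatures. $s\preceq t$ means there exists $x_0$ such that $s(x)\le t(x)$ for all $x>x_0$. $\epsilon_0=\sup\{\omega,\omega^\omega,\omega^{\omega^\omega},\dots\}$. *)

theory Defs
  imports "HOL-Library.FuncSet"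
begin

unbundle cardinal_syntax

text \<open>
  Term functions have the positive integers as domain. A function on them is represented by the
  extensional function with domain \<open>{1..}\<close>, so that equality of representatives is
  equality of functions there.
\<close>

inductive_set term_funs :: "(nat \<Rightarrow> nat) \<Rightarrow> (nat \<Rightarrow> nat) set" for h :: "nat \<Rightarrow> nat" where
  ident: "(\<lambda>x\<in>{1..}. x) \<in> term_funs h"
| plus: "\<lbrakk>f \<in> term_funs h; g \<in> term_funs h\<rbrakk> \<Longrightarrow> (\<lambda>x\<in>{1..}. f x + g x) \<in> term_funs h"
| app: "f \<in> term_funs h \<Longrightarrow> (\<lambda>x\<in>{1..}. h (f x)) \<in> term_funs h"

definition plus_fact_terms :: "(nat \<Rightarrow> nat) set" where
  "plus_fact_terms = term_funs fact"

definition plus_exp2_terms :: "(nat \<Rightarrow> nat) set" where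
  "plus_exp2_terms = term_funs (\<lambda>n. 2 ^ n)"

definition eventually_dominated :: "(nat \<Rightarrow> nat) \<Rightarrow> (nat \<Rightarrow> nat) \<Rightarrow> bool"  (infix \<open>\<preceq>\<close> 50) where
  "s \<preceq> t \<longleftrightarrow> (\<exists>x0. \<forall>x>x0. s x \<le> t x)"

definition dominance_order :: "(nat \<Rightarrow> nat) set \<Rightarrow> (nat \<Rightarrow> nat) rel" where
  "dominance_order A = {(s, t). s \<in> A \<and> t \<in> A \<and> s \<preceq> t}"

text \<open>
  The ordinal power \<open>\<omega>\<^sup>r\<close>: finitely supported functions from the field of \<open>r\<close> to the natural
  numbers, compared at the \<open>r\<close>-largest argument where they differ.
\<close>

definition omega_power :: "'a rel \<Rightarrow> ('a \<Rightarrow> nat) rel" where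
  "omega_power r =
    (let F = {f. finite {a. f a \<noteq> 0} \<and> {a. f a \<noteq> 0} \<subseteq> Field r} in
     {(f, g). f \<in> F \<and> g \<in> F \<and>
        (f = g \<or> (\<exists>a\<in>Field r. f a < g a \<and> (\<forall>b. (a, b) \<in> r \<and> b \<noteq> a \<longrightarrow> f b = g b)))})"

text \<open>
  The ordinals \<open>\<omega>, \<omega>\<^sup>\<omega>, \<dots>\<close>. Exponentiation changes the underlying type, so each member of
  the tower is given by all the well-orders on subsets of \<^typ>\<open>nat\<close> isomorphic to it; since these
  ordinals are countable, every one of them is represented.
\<close>

inductive omega_tower :: "nat rel \<Rightarrow> bool" where
  omega: "omega_tower natLeq"
| power: "\<lbrakk>omega_tower r; s =o omega_power r\<rbrakk> \<Longrightarrow> omega_tower s"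

text \<open>
  \<open>e\<close> is a well-order of type \<open>\<epsilon>\<^sub>0\<close>, the least upper bound of the tower. Comparing only with
  upper bounds on the type of \<open>e\<close> is no restriction: an upper bound strictly below \<open>e\<close> is
  isomorphic to an initial segment of \<open>e\<close>.
\<close>

definition has_order_type_epsilon0 :: "'a rel \<Rightarrow> bool" where
  "has_order_type_epsilon0 e \<longleftrightarrow>
     Well_order e \<and>
     (\<forall>r. omega_tower r \<longrightarrow> r \<le>o e) \<and>
     (\<forall>e' :: 'a rel. Well_order e' \<and> (\<forall>r. omega_tower r \<longrightarrow> r \<le>o e') \<longrightarrow> e \<le>o e')"

end

theory Submission
  imports Defs "HOL-Library.Multiset" "HOL-Library.Countable"
begin

text \<open>
  Let \<open>h\<close> be the factorial or \<open>n \<mapsto> 2\<^sup>n\<close>. Every term function is a nonempty sum of \<^emph>\<open>atoms\<close>, an atom being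
  the identity or \<open>h \<circ> v\<close> for a term function \<open>v\<close>. Two facts turn eventual dominance into an order
  on ordinal notations. If \<open>v - u\<close> tends to infinity, then \<open>h \<circ> u\<close> is negligible against \<open>h \<circ> v\<close>, and
  the identity is negligible against every \<open>h \<circ> v\<close>. If the atoms are linearly ordered by
  negligibility, then the largest atom whose multiplicities in two sums differ decides which sum is
  larger, and the difference of the sums tends to infinity. By induction on the nesting depth, any
  two term functions are equal or differ by an amount tending to infinity, and eventual dominance
  compares the multisets of atoms lexicographically.

  Writing \<open>\<alpha>\<close> for the order type, the atoms have type \<open>1 + \<alpha>\<close>, and finite multisets over
  an order of type \<open>\<beta>\<close> under the lexicographic comparison have type \<open>\<omega>\<^sup>\<beta>\<close>; so the term functions
  satisfy \<open>\<alpha> = \<omega>\<^sup>\<alpha>\<close>, up to the removal of the empty sum and the addition of the identity. Two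
  strictly monotone maps make this precise.

  Lower bound: a strictly monotone map \<open>f\<close> from \<open>r\<close> to the term functions yields one from
  \<open>\<omega>\<^sup>r\<close>, sending a multiset \<open>M\<close> to the sum of the identity and all \<open>h \<circ> f a\<close> with \<open>a\<close> in \<open>M\<close>; hence
  each member of the tower embeds (\<open>omega_tower_ordLeq\<close>).

  Upper bound: let \<open>below t\<close> consist of the term functions dominated by a multiple of \<open>t\<close>. The atoms
  occurring in members of \<open>below (h \<circ> u)\<close> are the identity and some \<open>h \<circ> v\<close> with \<open>v\<close> in \<open>below u\<close>, so a
  bound on \<open>below u\<close> by a tower member \<open>r\<close> gives a bound on \<open>below (h \<circ> u)\<close> by \<open>\<omega>\<^sup>r\<close>. By induction
  on \<open>t\<close>, every initial segment maps into a member of the tower (\<open>tower_bounded_below\<close>). This gives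
  well-foundedness, and shows that no proper initial segment of the dominance order can be an upper
  bound of the tower.
\<close>

section \<open>Strictly monotone maps between well-orders\<close>

definition strict :: "'a rel \<Rightarrow> 'a \<Rightarrow> 'a \<Rightarrow> bool" where
  "strict r a b \<longleftrightarrow> (a, b) \<in> r \<and> a \<noteq> b"

text \<open>
  Comparing ordinals takes only a strictly monotone map; its image may have gaps. The maps on multisets
  constructed below are of this kind.
\<close>

lemma ordLeq_if_strict_mono:
  assumes r: "Well_order r" and r': "Well_order r'"
    and into: "\<And>a. a \<in> Field r \<Longrightarrow> f a \<in> Field r'"
    and mono: "\<And>a b. strict r a b \<Longrightarrow> strict r' (f a) (f b)"
  shows "r \<le>o r'"
proof (rule ccontr)
  assume "\<not> r \<le>o r'"
  then have "r' <o r"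
    using r r' not_ordLeq_iff_ordLess by blast
  then obtain a where a: "a \<in> Field r" and "r' =o Restr r (underS r a)"
    using ordLess_iff_ordIso_Restr[OF r r'] by blast
  then obtain g where "iso r' (Restr r (underS r a)) g"
    unfolding ordIso_def by blast
  then have bij: "bij_betw g (Field r') (Field (Restr r (underS r a)))"
    and pres: "\<And>x y. x \<in> Field r' \<Longrightarrow> y \<in> Field r' \<Longrightarrow> (x, y) \<in> r' \<longleftrightarrow> (g x, g y) \<in> Restr r (underS r a)"
    unfolding iso_iff2 by auto
  have g_into: "g y \<in> underS r a" if "y \<in> Field r'" for y
    using bij_betw_apply[OF bij that] Field_Restr_subset[of r "underS r a"] by blast
  have g_mono: "strict r (g x) (g y)" if "strict r' x y" for x y
  proof -
    have "x \<in> Field r'" "y \<in> Field r'"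
      using that by (auto simp: strict_def Field_def)
    then show ?thesis
      using that pres[of x y] bij_betw_imp_inj_on[OF bij] unfolding strict_def
      by (auto dest: inj_onD)
  qed
  \<comment> \<open>A strictly monotone self-map of a well-order cannot move any point down, but \<open>g \<circ> f\<close> moves \<open>a\<close> down.\<close>
  have "wf (r - Id)"
    using r by (simp add: well_order_on_def)
  then have "\<not> strict r (g (f x)) x" for x
  proof (induction x)
    case (less x)
    show ?case
    proof
      assume *: "strict r (g (f x)) x"
      then have "\<not> strict r (g (f (g (f x)))) (g (f x))"
        using less.IH by (auto simp: strict_def)
      then show False
        using g_mono[OF mono[OF *]] by simp
    qed
  qed
  moreover have "strict r (g (f a)) a"
    using g_into[OF into[OF a]] by (auto simp: underS_def strict_def)
  ultimately show False
    by blast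
qed

lemma ordLeq_strict_mono_map:
  assumes "r \<le>o r'"
  obtains f where "\<And>a. a \<in> Field r \<Longrightarrow> f a \<in> Field r'"
    and "\<And>a b. strict r a b \<Longrightarrow> strict r' (f a) (f b)"
proof -
  obtain f where r: "Well_order r" and f: "embed r r' f"
    using assms unfolding ordLeq_def by blast
  have "strict r' (f a) (f b)" if "strict r a b" for a b
  proof -
    have "a \<in> Field r" "b \<in> Field r"
      using that by (auto simp: strict_def Field_def)
    then show ?thesis
      using that embed_compat[OF f] embed_inj_on[OF r f]
      unfolding strict_def compat_def inj_on_def by blast
  qed
  then show thesis
    using that embed_in_Field[OF f] by blast
qed

section \<open>Lexicographic comparison of multisets\<close>

text \<open>
  The comparison that \<^const>\<open>omega_power\<close> makes of finitely supported functions, for an arbitrary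
  relation. For linear orders it agrees with the Dershowitz--Manna multiset order.
\<close>

definition lex_less :: "('a \<Rightarrow> 'a \<Rightarrow> bool) \<Rightarrow> 'a multiset \<Rightarrow> 'a multiset \<Rightarrow> bool" where
  "lex_less P M N \<longleftrightarrow> (\<exists>a. count M a < count N a \<and> (\<forall>b. P a b \<longrightarrow> count M b = count N b))"

lemma lex_less_irrefl: "\<not> lex_less P M M"
  by (simp add: lex_less_def)

lemma lex_less_add_mset:
  "lex_less P M N \<Longrightarrow> lex_less P (add_mset c M) (add_mset c N)"
  unfolding lex_less_def by auto

locale strict_total_on =
  fixes S :: "'a set" and P :: "'a \<Rightarrow> 'a \<Rightarrow> bool"
  assumes irrefl: "a \<in> S \<Longrightarrow> \<not> P a a"
    and trans: "\<lbrakk>a \<in> S; b \<in> S; c \<in> S; P a b; P b c\<rbrakk> \<Longrightarrow> P a c"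
    and total: "\<lbrakk>a \<in> S; b \<in> S\<rbrakk> \<Longrightarrow> a = b \<or> P a b \<or> P b a"
begin

lemma lex_less_total:
  assumes M: "set_mset M \<subseteq> S" and N: "set_mset N \<subseteq> S"
  shows "M = N \<or> lex_less P M N \<or> lex_less P N M"
proof (cases "M = N")
  case False
  let ?D = "{a \<in> set_mset (M + N). count M a \<noteq> count N a}"
  have outside: "count M b = count N b" if "b \<notin> ?D" for b
    using that by (auto simp: not_in_iff)
  obtain d where "count M d \<noteq> count N d"
    using False by (auto simp: multiset_eq_iff)
  then have "?D \<noteq> {}"
    using outside by blast
  moreover have D: "finite ?D" "?D \<subseteq> S"
    using M N by auto
  moreover have "transp_on ?D P" "asymp_on ?D P"
    using D(2) irrefl trans unfolding transp_on_def asymp_on_def by blast+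
  ultimately obtain m where m: "m \<in> ?D" "\<forall>x\<in>?D. x \<noteq> m \<longrightarrow> \<not> P m x"
    using Finite_Set.bex_max_element[of ?D P] by blast
  have above: "count M b = count N b" if "P m b" for b
  proof (rule outside)
    have "m \<in> S"
      using m(1) D(2) by blast
    then show "b \<notin> ?D"
      using that irrefl m(2) by auto
  qed
  have "count M m < count N m \<or> count N m < count M m"
    using m(1) by auto
  then show ?thesis
    using above unfolding lex_less_def by fastforce
qed simp

lemma lex_less_trans:
  assumes "set_mset M \<subseteq> S" and N: "set_mset N \<subseteq> S" and K: "set_mset K \<subseteq> S"
    and "lex_less P M N" and "lex_less P N K"
  shows "lex_less P M K"
proof -
  obtain a where a: "count M a < count N a" "\<And>b. P a b \<Longrightarrow> count M b = count N b"
    using assms unfolding lex_less_def by blast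
  obtain b where b: "count N b < count K b" "\<And>c. P b c \<Longrightarrow> count N c = count K c"
    using assms unfolding lex_less_def by blast
  have S: "a \<in> S" "b \<in> S"
    using a(1) b(1) N K by (metis count_greater_zero_iff gr_implies_not0 gr0I subsetD)+
  have S': "c \<in> S" if "count M c \<noteq> count K c" for c
    using that assms(1) K by (metis not_in_iff subsetD)
  consider "a = b" | "P a b" | "P b a"
    using total[OF S] by blast
  then show ?thesis
  proof cases
    case 1
    then show ?thesis
      unfolding lex_less_def using a b by (metis order.strict_trans)
  next
    case 2
    then have "count M b < count K b"
      using a(2) b(1) by simp
    moreover have "count M c = count K c" if "P b c" for c
      using a(2) b(2) trans[OF S S' 2 that] that by fastforce
    ultimately show ?thesis
      unfolding lex_less_def by blast
  next
    case 3
    then have "count M a < count K a"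
      using a(1) b(2) by simp
    moreover have "count M c = count K c" if "P a c" for c
      using a(2) b(2) trans[OF S(2,1) S' 3 that] that by fastforce
    ultimately show ?thesis
      unfolding lex_less_def by blast
  qed
qed

text \<open>
  Well-foundedness of the lexicographic comparison comes from the multiset order: to pass from \<open>N\<close>
  down to \<open>M\<close>, drop copies of the deciding element \<open>a\<close>, and all elements gained are smaller than \<open>a\<close>.
\<close>

lemma lex_less_imp_mult:
  assumes M: "set_mset M \<subseteq> S" and N: "set_mset N \<subseteq> S" and less: "lex_less P M N"
  shows "(M, N) \<in> mult {(a, b). a \<in> S \<and> b \<in> S \<and> P a b}"
proof -
  obtain a where a: "count M a < count N a" "\<And>b. P a b \<Longrightarrow> count M b = count N b"
    using less unfolding lex_less_def by blast
  have aS: "a \<in> S"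
    using a(1) N by (metis count_greater_zero_iff gr_implies_not0 gr0I subsetD)
  have "a \<in># N - M"
    using a(1) by (simp add: in_diff_count)
  moreover have "P c a \<and> c \<in> S" if "c \<in># M - N" for c
  proof -
    have "count N c < count M c"
      using that by (simp add: in_diff_count)
    moreover have "c \<in> S"
      using that M by (meson in_diffD subsetD)
    ultimately show ?thesis
      using a aS total[of c a] by force
  qed
  ultimately have "(M \<inter># N + (M - N), M \<inter># N + (N - M)) \<in> mult {(a, b). a \<in> S \<and> b \<in> S \<and> P a b}"
    using aS by (intro one_step_implies_mult) auto
  moreover have "M \<inter># N + (M - N) = M" "M \<inter># N + (N - M) = N"
    by (auto intro!: multiset_eqI)
  ultimately show ?thesis
    by simp
qed

text \<open>
  Asymmetry of \<open>Q\<close> on the image and totality of \<open>P\<close> make \<open>f\<close> injective on \<open>S\<close> and order-reflecting,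
  so multiplicities are carried over and the image of the deciding element decides again. This
  lemma transports the comparison from ordinals to atoms and back.
\<close>

lemma lex_less_image:
  assumes mono: "\<And>a b. \<lbrakk>a \<in> S; b \<in> S; P a b\<rbrakk> \<Longrightarrow> Q (f a) (f b)"
    and asym: "\<And>a b. \<lbrakk>a \<in> S; b \<in> S; Q (f a) (f b)\<rbrakk> \<Longrightarrow> \<not> Q (f b) (f a)"
    and M: "set_mset M \<subseteq> S" and N: "set_mset N \<subseteq> S" and less: "lex_less P M N"
  shows "lex_less Q (image_mset f M) (image_mset f N)"
proof -
  have inj: "f a = f b \<longleftrightarrow> a = b" if "a \<in> S" "b \<in> S" for a b
    using total[OF that] mono asym that by metis
  have count: "count (image_mset f K) (f a) = count K a" if "set_mset K \<subseteq> S" "a \<in> S" for K a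
    using that by (induction K) (auto simp: inj)
  obtain a where a: "count M a < count N a" "\<And>b. P a b \<Longrightarrow> count M b = count N b"
    using less unfolding lex_less_def by blast
  have aS: "a \<in> S"
    using a(1) N by (metis count_greater_zero_iff gr_implies_not0 gr0I subsetD)
  have "count (image_mset f M) c = count (image_mset f N) c" if "Q (f a) c" for c
  proof (cases "c \<in> f ` S")
    case True
    then obtain b where b: "b \<in> S" "c = f b"
      by blast
    then have "P a b"
      using total[OF aS b(1)] that mono[OF b(1) aS] asym[OF aS b(1)] asym[OF aS aS] by auto
    then show ?thesis
      using a(2) b count M N by simp
  next
    case False
    then have "c \<notin># image_mset f M" "c \<notin># image_mset f N"
      using M N by auto
    then show ?thesis
      by (metis not_in_iff)
  qed
  then show ?thesis
    unfolding lex_less_def using a(1) aS count M N by metis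
qed

end

lemma strict_total_on_subset:
  assumes "strict_total_on S P" "A \<subseteq> S"
  shows "strict_total_on A P"
proof -
  interpret strict_total_on S P
    by (rule assms(1))
  show ?thesis
  proof
    show "P a c" if "a \<in> A" "b \<in> A" "c \<in> A" "P a b" "P b c" for a b c
      using trans[of a b c] that assms(2) by auto
  qed (use irrefl total assms(2) in auto)
qed

lemma strict_total_on_Field:
  assumes "Well_order r"
  shows "strict_total_on (Field r) (strict r)"
proof -
  have "trans r" "antisym r" "total_on (Field r) r"
    using assms by (auto simp: order_on_defs)
  then show ?thesis
    unfolding strict_total_on_def strict_def trans_def antisym_def total_on_def by blast
qed

section \<open>The ordinal power and the tower\<close>

text \<open>
  Finitely supported functions to the natural numbers are the multiplicity functions of multisets.
\<close>

lemma omega_power_count: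
  "omega_power r = {(count M, count N) | M N. set_mset M \<subseteq> Field r \<and> set_mset N \<subseteq> Field r \<and>
     (M = N \<or> lex_less (strict r) M N)}" (is "_ = ?R")
proof -
  have count: "\<exists>M. f = count M" if "finite {a. f a \<noteq> 0}" for f :: "'a \<Rightarrow> nat"
    using count_Abs_multiset[of f] that by (intro exI[of _ "Abs_multiset f"]) simp
  have supp: "{a. count M a \<noteq> 0} = set_mset M" for M :: "'a multiset"
    by auto
  have less: "(\<exists>a\<in>Field r. count M a < count N a \<and> (\<forall>b. (a, b) \<in> r \<and> b \<noteq> a \<longrightarrow> count M b = count N b))
      \<longleftrightarrow> lex_less (strict r) M N" if "set_mset N \<subseteq> Field r" for M N :: "'a multiset"
  proof -
    have "a \<in> Field r" if "count M a < count N a" for a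
      using that \<open>set_mset N \<subseteq> Field r\<close> by (metis count_greater_zero_iff gr_implies_not0 gr0I subsetD)
    then show ?thesis
      unfolding lex_less_def strict_def by metis
  qed
  show ?thesis
  proof (intro set_eqI iffI)
    fix p assume p: "p \<in> omega_power r"
    obtain f g where fg: "p = (f, g)" by fastforce
    then have "finite {a. f a \<noteq> 0}" "finite {a. g a \<noteq> 0}"
      using p by (auto simp: omega_power_def Let_def)
    then obtain M N where "f = count M" "g = count N"
      using count by blast
    then show "p \<in> ?R"
      using p fg less[of N M] by (auto simp: omega_power_def Let_def supp count_inject)
  next
    fix p assume "p \<in> ?R"
    then obtain M N where "p = (count M, count N)" "set_mset M \<subseteq> Field r" "set_mset N \<subseteq> Field r"
      "M = N \<or> lex_less (strict r) M N"
      by blast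
    then show "p \<in> omega_power r"
      using less[of N M] by (auto simp: omega_power_def Let_def supp)
  qed
qed

lemma strict_omega_power:
  "strict (omega_power r) (count M) (count N) \<longleftrightarrow>
     set_mset M \<subseteq> Field r \<and> set_mset N \<subseteq> Field r \<and> lex_less (strict r) M N"
  unfolding strict_def omega_power_count by (auto simp: count_inject lex_less_irrefl)

lemma Field_omega_power: "Field (omega_power r) = count ` {M. set_mset M \<subseteq> Field r}"
  unfolding omega_power_count Field_def by auto

lemma Well_order_omega_power:
  assumes r: "Well_order r"
  shows "Well_order (omega_power r)"
proof -
  interpret strict_total_on "Field r" "strict r"
    by (rule strict_total_on_Field[OF r])
  let ?w = "omega_power r"
  let ?m = "mult {(a, b). a \<in> Field r \<and> b \<in> Field r \<and> strict r a b}"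
  have "refl_on (Field ?w) ?w"
    unfolding Field_omega_power unfolding omega_power_count refl_on_def by auto
  moreover have "trans ?w"
    unfolding omega_power_count trans_def
    by (clarsimp simp: count_inject) (metis lex_less_trans)
  moreover have "antisym ?w"
    unfolding omega_power_count antisym_def
    by (clarsimp simp: count_inject) (metis lex_less_trans lex_less_irrefl)
  moreover have "total_on (Field ?w) ?w"
    unfolding Field_omega_power unfolding omega_power_count total_on_def
    by (clarsimp simp: count_inject) (metis lex_less_total)
  moreover have "wf (?w - Id)"
  proof (rule wf_subset)
    have "wf (r - Id)"
      using r by (simp add: well_order_on_def)
    then have "wf ?m"
      by (intro wf_mult) (auto elim!: wf_subset simp: strict_def)
    then show "wf (inv_image ?m Abs_multiset)"
      by (rule wf_inv_image)
    show "?w - Id \<subseteq> inv_image ?m Abs_multiset"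
      unfolding omega_power_count
      by (auto simp: count_inverse intro: lex_less_imp_mult)
  qed
  ultimately show ?thesis
    by (auto simp: order_on_defs Field_def)
qed

lemma omega_tower_Well_order: "omega_tower r \<Longrightarrow> Well_order r"
proof (induction rule: omega_tower.induct)
  case omega
  show ?case by (rule natLeq_Well_order)
qed (simp add: ordIso_def)

text \<open>
  The tower consists of orders on \<^typ>\<open>nat\<close>, whereas \<^const>\<open>omega_power\<close> leaves that type; countability
  of the multisets over \<^typ>\<open>nat\<close> provides the isomorphic copy.
\<close>

lemma omega_tower_power:
  assumes r: "omega_tower r"
  obtains s where "omega_tower s" "omega_power r =o s"
proof -
  let ?f = "\<lambda>\<phi> :: nat \<Rightarrow> nat. to_nat (sorted_list_of_multiset (Abs_multiset \<phi>))"
  have "inj_on ?f (Field (omega_power r))"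
    unfolding Field_omega_power
  proof (rule inj_on_imageI)
    have "inj (sorted_list_of_multiset :: nat multiset \<Rightarrow> nat list)"
      by (metis injI mset_sorted_list_of_multiset)
    then show "inj_on (?f \<circ> count) {M. set_mset M \<subseteq> Field r}"
      by (auto simp: inj_on_def count_inverse)
  qed
  then have "omega_power r =o dir_image (omega_power r) ?f"
    by (intro dir_image_ordIso Well_order_omega_power omega_tower_Well_order r)
  then show thesis
    using that omega_tower.power[OF r] ordIso_symmetric by blast
qed

section \<open>Growth of sums\<close>

lemma dominated_iff_eventually: "s \<preceq> t \<longleftrightarrow> (\<forall>\<^sub>F x in sequentially. s x \<le> t x)"
  unfolding eventually_dominated_def eventually_at_top_dense by simp

lemma eventually_sequentially_ex: "\<forall>\<^sub>F x in sequentially. Q x \<Longrightarrow> \<exists>x\<ge>n. Q x" for n :: nat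
  by (metis eventually_sequentially linorder_le_cases)

definition growing :: "(nat \<Rightarrow> nat) \<Rightarrow> bool" where
  "growing f \<longleftrightarrow> (\<forall>x\<ge>1. x \<le> f x)"

definition negligible :: "(nat \<Rightarrow> nat) \<Rightarrow> (nat \<Rightarrow> nat) \<Rightarrow> bool"  (infix \<open>\<lless>\<close> 50) where
  "a \<lless> b \<longleftrightarrow> (\<forall>k. \<forall>\<^sub>F x in sequentially. k * a x \<le> b x)"

definition diverging_gap :: "(nat \<Rightarrow> nat) \<Rightarrow> (nat \<Rightarrow> nat) \<Rightarrow> bool"  (infix \<open>\<prec>\<close> 50) where
  "s \<prec> t \<longleftrightarrow> (\<forall>m. \<forall>\<^sub>F x in sequentially. s x + m \<le> t x)"

lemma negligible_trans:
  assumes "a \<lless> b" "b \<lless> c"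
  shows "a \<lless> c"
  unfolding negligible_def
proof
  fix k
  have "\<forall>\<^sub>F x in sequentially. k * a x \<le> b x" "\<forall>\<^sub>F x in sequentially. 1 * b x \<le> c x"
    using assms unfolding negligible_def by blast+
  then show "\<forall>\<^sub>F x in sequentially. k * a x \<le> c x"
    by eventually_elim simp
qed

lemma negligible_irrefl:
  assumes "growing a"
  shows "\<not> a \<lless> a"
proof
  assume "a \<lless> a"
  then have "\<forall>\<^sub>F x in sequentially. 2 * a x \<le> a x"
    unfolding negligible_def by blast
  then obtain x where "x \<ge> 1" "2 * a x \<le> a x"
    using eventually_sequentially_ex by blast
  then show False
    using assms by (fastforce simp: growing_def)
qed

lemma diverging_gap_trans:
  assumes "s \<prec> t" "t \<prec> u"
  shows "s \<prec> u"
  unfolding diverging_gap_def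
proof
  fix m
  have "\<forall>\<^sub>F x in sequentially. s x + m \<le> t x" "\<forall>\<^sub>F x in sequentially. t x + 0 \<le> u x"
    using assms unfolding diverging_gap_def by blast+
  then show "\<forall>\<^sub>F x in sequentially. s x + m \<le> u x"
    by eventually_elim simp
qed

lemma diverging_gap_imp_dominated: "s \<prec> t \<Longrightarrow> s \<preceq> t"
  unfolding diverging_gap_def dominated_iff_eventually by (drule spec[of _ 0]) simp

lemma diverging_gap_not_dominated:
  assumes "s \<prec> t"
  shows "\<not> t \<preceq> s"
proof
  assume "t \<preceq> s"
  then have "\<forall>\<^sub>F x in sequentially. t x \<le> s x"
    by (simp add: dominated_iff_eventually)
  moreover have "\<forall>\<^sub>F x in sequentially. s x + 1 \<le> t x"
    using assms unfolding diverging_gap_def by blast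
  ultimately have "\<forall>\<^sub>F x :: nat in sequentially. False"
    by eventually_elim simp
  then show False
    by simp
qed

lemma diverging_gap_irrefl: "\<not> s \<prec> s"
  using diverging_gap_imp_dominated diverging_gap_not_dominated by blast

definition msum :: "(nat \<Rightarrow> nat) multiset \<Rightarrow> nat \<Rightarrow> nat" where
  "msum M = (\<lambda>x\<in>{1..}. \<Sum>a\<in>#M. a x)"

lemma msum_apply: "x \<ge> 1 \<Longrightarrow> msum M x = (\<Sum>a\<in>#M. a x)"
  by (simp add: msum_def)

lemma le_msum:
  assumes "a \<in># M" "x \<ge> 1"
  shows "a x \<le> msum M x"
  using multi_member_split[OF assms(1)] assms(2) by (auto simp: msum_apply)

lemma growing_msum:
  assumes "M \<noteq> {#}" "\<forall>a\<in>#M. growing a"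
  shows "growing (msum M)"
proof -
  obtain a where "a \<in># M"
    using assms(1) by blast
  then show ?thesis
    using assms(2) le_msum unfolding growing_def by (meson order_trans)
qed

text \<open>
  A finite sum of negligible functions is negligible; this lets the largest differing atom outweigh
  all smaller ones together.
\<close>

lemma negligible_sum:
  assumes "\<forall>b\<in>#K. b \<lless> a"
  shows "(\<lambda>x. \<Sum>b\<in>#K. b x) \<lless> a"
  using assms
proof (induction K)
  case empty
  then show ?case
    by (simp add: negligible_def)
next
  case (add b K)
  show ?case
    unfolding negligible_def
  proof
    fix k
    have "\<forall>\<^sub>F x in sequentially. (2 * k) * b x \<le> a x"
      "\<forall>\<^sub>F x in sequentially. (2 * k) * (\<Sum>b\<in>#K. b x) \<le> a x"
      using add unfolding negligible_def by auto
    then show "\<forall>\<^sub>F x in sequentially. k * (\<Sum>b\<in>#add_mset b K. b x) \<le> a x"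
      by eventually_elim (simp add: algebra_simps)
  qed
qed

text \<open>
  Split both sums at the deciding atom \<open>a\<close>. The parts above \<open>a\<close> coincide, the second sum has at least
  one more copy of \<open>a\<close>, and that copy exceeds the part of the first sum below \<open>a\<close> by at least half of \<open>a\<close>,
  which tends to infinity.
\<close>

lemma lex_less_imp_diverging_gap:
  assumes S: "strict_total_on S (\<lless>)" and gr: "\<forall>a\<in>S. growing a"
    and M: "set_mset M \<subseteq> S" and N: "set_mset N \<subseteq> S" and less: "lex_less (\<lless>) M N"
  shows "msum M \<prec> msum N"
  unfolding diverging_gap_def
proof
  fix m
  interpret strict_total_on S "(\<lless>)"
    by (rule S)
  obtain a where a: "count M a < count N a" and above: "\<And>b. a \<lless> b \<Longrightarrow> count M b = count N b"
    using less unfolding lex_less_def by blast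
  have aS: "a \<in> S"
    using a N by (metis count_greater_zero_iff gr_implies_not0 gr0I subsetD)
  \<comment> \<open>\<open>U\<close> is also the part of \<open>N\<close> above \<open>a\<close>, by the choice of \<open>a\<close>.\<close>
  define U where "U = {#b \<in># M. a \<lless> b#}"
  define K where "K = {#b \<in># M. b \<lless> a#}"
  have irr: "\<not> a \<lless> a"
    using irrefl aS by blast
  have M_eq: "M = U + replicate_mset (count M a) a + K"
  proof (rule multiset_eqI)
    fix b
    have "b \<in># M \<Longrightarrow> a \<lless> b \<Longrightarrow> \<not> b \<lless> a"
      using irr negligible_trans by blast
    then show "count M b = count (U + replicate_mset (count M a) a + K) b"
      using total[OF aS, of b] M irr by (cases "b \<in># M") (auto simp: U_def K_def not_in_iff)
  qed
  have N_ge: "U + replicate_mset (count M a + 1) a \<subseteq># N"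
  proof (rule mset_subset_eqI)
    fix b
    show "count (U + replicate_mset (count M a + 1) a) b \<le> count N b"
      using a above[of b] irr by (auto simp: U_def)
  qed
  then obtain L where N_eq: "N = U + replicate_mset (count M a + 1) a + L"
    by (metis mset_subset_eq_exists_conv)
  have "(\<lambda>x. \<Sum>b\<in>#K. b x) \<lless> a"
    by (rule negligible_sum) (simp add: K_def)
  then have "\<forall>\<^sub>F x in sequentially. 2 * (\<Sum>b\<in>#K. b x) \<le> a x"
    unfolding negligible_def by blast
  then show "\<forall>\<^sub>F x in sequentially. msum M x + m \<le> msum N x"
    using eventually_ge_at_top[of "max 1 (2 * m)"]
  proof eventually_elim
    case (elim x)
    then have x: "x \<ge> 1" "2 * m \<le> x"
      by auto
    then have "x \<le> a x"
      using gr aS by (auto simp: growing_def)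
    have "msum M x = (\<Sum>b\<in>#U. b x) + count M a * a x + (\<Sum>b\<in>#K. b x)"
      by (subst M_eq) (simp add: msum_apply[OF x(1)])
    moreover have "msum N x = (\<Sum>b\<in>#U. b x) + (count M a * a x + a x) + (\<Sum>b\<in>#L. b x)"
      by (subst N_eq) (simp add: msum_apply[OF x(1)])
    ultimately show ?case
      using elim(1) x(2) \<open>x \<le> a x\<close> by linarith
  qed
qed

definition ident :: "nat \<Rightarrow> nat" where
  "ident = (\<lambda>x\<in>{1..}. x)"

lemma growing_ident: "growing ident"
  by (simp add: ident_def growing_def)

definition sums :: "(nat \<Rightarrow> nat) set \<Rightarrow> (nat \<Rightarrow> nat) set" where
  "sums S = {msum M | M. M \<noteq> {#} \<and> set_mset M \<subseteq> S}"

lemma msum_in_sums: "\<lbrakk>M \<noteq> {#}; set_mset M \<subseteq> S\<rbrakk> \<Longrightarrow> msum M \<in> sums S"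
  unfolding sums_def by blast

lemma sums_mono: "S \<subseteq> S' \<Longrightarrow> sums S \<subseteq> sums S'"
  unfolding sums_def by blast

lemma growing_sums: "\<forall>a\<in>S. growing a \<Longrightarrow> \<forall>s\<in>sums S. growing s"
  unfolding sums_def using growing_msum by blast

lemma strict_total_on_sums:
  assumes S: "strict_total_on S (\<lless>)" and gr: "\<forall>a\<in>S. growing a"
  shows "strict_total_on (sums S) (\<prec>)"
proof
  fix s t assume "s \<in> sums S" "t \<in> sums S"
  then obtain M N where "s = msum M" "t = msum N" "set_mset M \<subseteq> S" "set_mset N \<subseteq> S"
    unfolding sums_def by blast
  then show "s = t \<or> s \<prec> t \<or> t \<prec> s"
    using strict_total_on.lex_less_total[OF S] lex_less_imp_diverging_gap[OF S gr] by metis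
qed (auto simp: diverging_gap_irrefl intro: diverging_gap_trans)

section \<open>Term functions over a rapidly growing function\<close>

text \<open>
  The growth that the argument extracts from \<open>h\<close>: a large enough shift of the argument multiplies
  the value by any prescribed factor. One step suffices for the factorial at large arguments, and
  \<open>k\<close> steps suffice for powers of two.
\<close>

locale rapid_growth =
  fixes h :: "nat \<Rightarrow> nat"
  assumes mono_h: "mono h"
    and ge_h: "n \<le> h n"
    and jump_h: "\<exists>m. \<forall>\<^sub>F n in sequentially. k * h n \<le> h (n + m)"
begin

definition happ :: "(nat \<Rightarrow> nat) \<Rightarrow> nat \<Rightarrow> nat" where
  "happ v = (\<lambda>x\<in>{1..}. h (v x))"

definition atoms :: "(nat \<Rightarrow> nat) set \<Rightarrow> (nat \<Rightarrow> nat) set" where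
  "atoms B = insert ident (happ ` B)"

lemma atoms_mono: "B \<subseteq> B' \<Longrightarrow> atoms B \<subseteq> atoms B'"
  unfolding atoms_def by blast

lemma growing_happ: "growing v \<Longrightarrow> growing (happ v)"
  unfolding growing_def happ_def using ge_h order_trans by fastforce

lemma growing_atoms: "\<forall>v\<in>B. growing v \<Longrightarrow> \<forall>a\<in>atoms B. growing a"
  unfolding atoms_def using growing_ident growing_happ by blast

text \<open>
  Compare with the value \<open>m\<close> steps earlier: \<open>h n \<ge> 2k h (n - m) \<ge> 2k (n - m) \<ge> kn\<close> once \<open>n\<close> is at
  least \<open>2m\<close>.
\<close>

lemma superlinear_h: "\<forall>\<^sub>F n in sequentially. k * n \<le> h n"
proof -
  obtain m where "\<forall>\<^sub>F n in sequentially. 2 * k * h n \<le> h (n + m)"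
    using jump_h by blast
  then obtain n0 where n0: "\<And>n. n \<ge> n0 \<Longrightarrow> 2 * k * h n \<le> h (n + m)"
    unfolding eventually_sequentially by blast
  have "k * n \<le> h n" if "n \<ge> n0 + 2 * m" for n
  proof -
    have "k * n \<le> k * (2 * (n - m))"
      using that by (intro mult_le_mono) auto
    also have "\<dots> \<le> 2 * k * h (n - m)"
      using ge_h[of "n - m"] by simp
    also have "\<dots> \<le> h n"
      using n0[of "n - m"] that by simp
    finally show ?thesis .
  qed
  then show ?thesis
    unfolding eventually_sequentially by blast
qed

lemma ident_negligible_happ:
  assumes "growing v"
  shows "ident \<lless> happ v"
  unfolding negligible_def
proof
  fix k
  show "\<forall>\<^sub>F x in sequentially. k * ident x \<le> happ v x"
    using superlinear_h[of k] eventually_ge_at_top[of 1]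
  proof eventually_elim
    case (elim x)
    then have "h x \<le> h (v x)"
      using assms mono_h by (auto simp: growing_def monoD)
    then show ?case
      using elim by (simp add: ident_def happ_def)
  qed
qed

lemma happ_negligible_happ:
  assumes gr: "growing u" and gap: "u \<prec> v"
  shows "happ u \<lless> happ v"
  unfolding negligible_def
proof
  fix k
  obtain m n0 where jump: "\<And>n. n \<ge> n0 \<Longrightarrow> k * h n \<le> h (n + m)"
    using jump_h[of k] unfolding eventually_sequentially by blast
  have "\<forall>\<^sub>F x in sequentially. u x + m \<le> v x"
    using gap unfolding diverging_gap_def by blast
  then show "\<forall>\<^sub>F x in sequentially. k * happ u x \<le> happ v x"
    using eventually_ge_at_top[of "max 1 n0"]
  proof eventually_elim
    case (elim x)
    then have "n0 \<le> u x"
      using gr by (force simp: growing_def)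
    then have "k * h (u x) \<le> h (u x + m)"
      by (rule jump)
    also have "\<dots> \<le> h (v x)"
      using elim(1) mono_h by (rule monoD[rotated])
    finally show ?case
      using elim(2) by (simp add: happ_def)
  qed
qed

lemma strict_total_on_atoms:
  assumes B: "strict_total_on B (\<prec>)" and gr: "\<forall>v\<in>B. growing v"
  shows "strict_total_on (atoms B) (\<lless>)"
proof
  fix a b assume "a \<in> atoms B" "b \<in> atoms B"
  then show "a = b \<or> a \<lless> b \<or> b \<lless> a"
    unfolding atoms_def
    using ident_negligible_happ happ_negligible_happ gr strict_total_on.total[OF B] by blast
qed (use growing_atoms[OF gr] in \<open>auto simp: negligible_irrefl intro: negligible_trans\<close>)

abbreviation terms :: "(nat \<Rightarrow> nat) set" where
  "terms \<equiv> term_funs h"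

lemma sums_atoms_in_terms:
  assumes "B \<subseteq> terms"
  shows "sums (atoms B) \<subseteq> terms"
proof -
  have atom: "a \<in> terms" if "a \<in> atoms B" for a
    using that assms term_funs.ident term_funs.app unfolding atoms_def ident_def happ_def by blast
  have "msum M \<in> terms" if "M \<noteq> {#}" "set_mset M \<subseteq> atoms B" for M
    using that
  proof (induction M)
    case (add a M)
    then have a: "a \<in> terms"
      using atom by simp
    show ?case
    proof (cases "M = {#}")
      case True
      have "a \<in> extensional {1..}"
        using add.prems by (auto simp: atoms_def ident_def happ_def)
      then have "msum {#a#} = a"
        using add.prems by (auto simp: msum_def extensional_restrict)
      then show ?thesis
        using a True by simp
    next
      case False
      then have "(\<lambda>x\<in>{1..}. a x + msum M x) \<in> terms"
        using add a by (intro term_funs.plus) auto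
      also have "(\<lambda>x\<in>{1..}. a x + msum M x) = msum (add_mset a M)"
        by (auto simp: msum_def)
      finally show ?thesis .
    qed
  qed simp
  then show ?thesis
    unfolding sums_def by blast
qed

text \<open>
  Stratification of the term functions by nesting depth of \<open>h\<close>. Comparability of the atoms at one
  depth needs comparability of the arguments of \<open>h\<close>, which live one depth lower.
\<close>

fun level :: "nat \<Rightarrow> (nat \<Rightarrow> nat) set" where
  "level 0 = {}"
| "level (Suc n) = sums (atoms (level n))"

lemma level_mono: "level n \<subseteq> level (n + k)"
proof (induction n)
  case (Suc n)
  then show ?case
    by (simp add: sums_mono atoms_mono)
qed simp

lemma level_mono': "n \<le> m \<Longrightarrow> level n \<subseteq> level m"
  using level_mono[of n "m - n"] by simp

lemma strict_total_on_level: "strict_total_on (level n) (\<prec>) \<and> (\<forall>s\<in>level n. growing s)"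
proof (induction n)
  case 0
  show ?case
    by (simp add: strict_total_on_def)
next
  case (Suc n)
  then show ?case
    using strict_total_on_sums[of "atoms (level n)"] strict_total_on_atoms[of "level n"]
      growing_atoms[of "level n"] growing_sums[of "atoms (level n)"] by auto
qed

lemma terms_eq_levels: "terms = (\<Union>n. level n)"
proof
  show "(\<Union>n. level n) \<subseteq> terms"
  proof clarify
    fix n s assume "s \<in> level n"
    moreover have "level n \<subseteq> terms"
      by (induction n) (use sums_atoms_in_terms in auto)
    ultimately show "s \<in> terms"
      by blast
  qed
  show "terms \<subseteq> (\<Union>n. level n)"
  proof
    fix s assume "s \<in> terms"
    then show "s \<in> (\<Union>n. level n)"
    proof induction
      case ident
      have "msum {#ident#} = (\<lambda>x\<in>{1..}. x)"
        by (auto simp: msum_def ident_def)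
      then have "(\<lambda>x\<in>{1..}. x) \<in> level (Suc 0)"
        using msum_in_sums[of "{#ident#}" "atoms (level 0)"] by (simp add: atoms_def)
      then show ?case
        by blast
    next
      case (plus f g)
      then obtain m n where "f \<in> level m" "g \<in> level n"
        by blast
      then have "f \<in> level (Suc (m + n))" "g \<in> level (Suc (m + n))"
        using level_mono'[of m "Suc (m + n)"] level_mono'[of n "Suc (m + n)"] by auto
      then obtain M N where "f = msum M" "g = msum N" "M \<noteq> {#}"
        "set_mset (M + N) \<subseteq> atoms (level (m + n))"
        by (auto simp: sums_def)
      moreover from this have "(\<lambda>x\<in>{1..}. f x + g x) = msum (M + N)"
        by (auto simp: msum_def)
      ultimately have "(\<lambda>x\<in>{1..}. f x + g x) \<in> level (Suc (m + n))"
        using msum_in_sums[of "M + N" "atoms (level (m + n))"] by simp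
      then show ?case
        by blast
    next
      case (app f)
      then obtain n where "f \<in> level n"
        by blast
      moreover have "msum {#happ f#} = (\<lambda>x\<in>{1..}. h (f x))"
        by (auto simp: msum_def happ_def)
      ultimately have "(\<lambda>x\<in>{1..}. h (f x)) \<in> level (Suc n)"
        using msum_in_sums[of "{#happ f#}" "atoms (level n)"] by (simp add: atoms_def)
      then show ?case
        by blast
    qed
  qed
qed

lemma growing_terms: "s \<in> terms \<Longrightarrow> growing s"
  using strict_total_on_level terms_eq_levels by blast

lemma strict_total_on_terms: "strict_total_on terms (\<prec>)"
proof
  fix s t assume "s \<in> terms" "t \<in> terms"
  then obtain m n where "s \<in> level m" "t \<in> level n"
    unfolding terms_eq_levels by blast
  then have "s \<in> level (m + n)" "t \<in> level (m + n)"
    using level_mono'[of m "m + n"] level_mono'[of n "m + n"] by auto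
  then show "s = t \<or> s \<prec> t \<or> t \<prec> s"
    using strict_total_on_level[of "m + n"] by (auto dest: strict_total_on.total)
qed (auto simp: diverging_gap_irrefl intro: diverging_gap_trans)

lemma terms_eq_sums: "terms = sums (atoms terms)"
proof
  show "terms \<subseteq> sums (atoms terms)"
  proof
    fix s assume "s \<in> terms"
    then obtain n where "s \<in> level n"
      unfolding terms_eq_levels by blast
    then obtain k where "s \<in> sums (atoms (level k))"
      by (cases n) auto
    moreover have "level k \<subseteq> terms"
      using terms_eq_levels by blast
    ultimately show "s \<in> sums (atoms terms)"
      using sums_mono[OF atoms_mono] by blast
  qed
qed (rule sums_atoms_in_terms, simp)

lemmas terms_total = strict_total_on.total[OF strict_total_on_terms]

lemma growing_atoms_terms: "\<forall>a\<in>atoms terms. growing a"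
  by (rule growing_atoms) (simp add: growing_terms)

lemma strict_total_on_atoms_terms: "strict_total_on (atoms terms) (\<lless>)"
  by (rule strict_total_on_atoms[OF strict_total_on_terms]) (simp add: growing_terms)

lemma strict_dominance_order:
  "strict (dominance_order terms) s t \<longleftrightarrow> s \<in> terms \<and> t \<in> terms \<and> s \<prec> t"
  unfolding strict_def dominance_order_def
  using terms_total[of s t] diverging_gap_imp_dominated diverging_gap_not_dominated diverging_gap_irrefl
  by blast

lemma Field_dominance_order: "Field (dominance_order terms) = terms"
  unfolding dominance_order_def Field_def by (auto simp: eventually_dominated_def)

section \<open>Initial segments lie below the tower\<close>

text \<open>
  \<open>B\<close> maps strictly monotonically into a member of the tower, avoiding a point \<open>z\<close> below the image.
  That point is reserved for the identity when passing to atoms: it realises the \<open>1 +\<close> in the type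
  \<open>1 + \<beta>\<close> of the atoms over \<open>B\<close>, and makes the invariant reproduce itself.
\<close>

definition tower_bounded :: "(nat \<Rightarrow> nat) set \<Rightarrow> bool" where
  "tower_bounded B \<longleftrightarrow> (\<exists>r z g. omega_tower r \<and> z \<in> Field r \<and> (\<forall>s\<in>B. strict r z (g s)) \<and>
     (\<forall>s\<in>B. \<forall>t\<in>B. s \<prec> t \<longrightarrow> strict r (g s) (g t)))"

lemma tower_bounded_subset:
  assumes "tower_bounded B" "A \<subseteq> B"
  shows "tower_bounded A"
proof -
  obtain r z g where rzg: "omega_tower r \<and> z \<in> Field r \<and> (\<forall>s\<in>B. strict r z (g s)) \<and>
     (\<forall>s\<in>B. \<forall>t\<in>B. s \<prec> t \<longrightarrow> strict r (g s) (g t))"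
    using assms(1) unfolding tower_bounded_def by (elim exE)
  show ?thesis
    unfolding tower_bounded_def
    by (intro exI[of _ r] exI[of _ z] exI[of _ g]) (use rzg assms(2) in auto)
qed

text \<open>
  Send the identity to the reserved point \<open>z\<close> and \<open>h \<circ> v\<close> to \<open>g v\<close>. Applying this to the multiset of
  atoms of a sum gives an element of \<open>\<omega>\<^sup>r\<close>, and the empty multiset, which represents no sum, is the new
  reserved point.
\<close>

lemma tower_bounded_sums_atoms:
  assumes B: "B \<subseteq> terms" and bounded: "tower_bounded B"
  shows "tower_bounded (sums (atoms B))"
proof -
  obtain r z g where rzg: "omega_tower r \<and> z \<in> Field r \<and> (\<forall>s\<in>B. strict r z (g s)) \<and>
     (\<forall>s\<in>B. \<forall>t\<in>B. s \<prec> t \<longrightarrow> strict r (g s) (g t))"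
    using bounded unfolding tower_bounded_def by (elim exE)
  then have r: "omega_tower r" and z: "z \<in> Field r"
    and zg: "\<And>s. s \<in> B \<Longrightarrow> strict r z (g s)"
    and g: "\<And>s t. \<lbrakk>s \<in> B; t \<in> B; s \<prec> t\<rbrakk> \<Longrightarrow> strict r (g s) (g t)"
    by auto
  have wr: "Well_order r"
    by (rule omega_tower_Well_order[OF r])
  have gr: "growing v" if "v \<in> B" for v
    using that B growing_terms by blast
  have totB: "u = v \<or> u \<prec> v \<or> v \<prec> u" if "u \<in> B" "v \<in> B" for u v
    using that B terms_total by blast
  interpret at: strict_total_on "atoms B" "(\<lless>)"
    by (rule strict_total_on_subset[OF strict_total_on_atoms_terms atoms_mono[OF B]])
  interpret fr: strict_total_on "Field r" "strict r"
    by (rule strict_total_on_Field[OF wr])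
  have grat: "\<forall>a\<in>atoms B. growing a"
    by (rule growing_atoms) (simp add: gr)
  have happ_less: "u \<prec> v" if "u \<in> B" "v \<in> B" "happ u \<lless> happ v" for u v
    using totB[OF that(1,2)] that(3) happ_negligible_happ[OF gr[OF that(2)], of u]
      negligible_irrefl[OF growing_happ[OF gr[OF that(1)]]] negligible_trans[of "happ u" "happ v" "happ u"]
    by auto
  have inj: "inj_on happ B"
  proof (rule inj_onI)
    fix u v assume uv: "u \<in> B" "v \<in> B" "happ u = happ v"
    then show "u = v"
      using totB[OF uv(1,2)] happ_negligible_happ[OF gr, of u v] happ_negligible_happ[OF gr, of v u]
        negligible_irrefl[OF growing_happ[OF gr[OF uv(1)]]] by auto
  qed
  have ident_notin: "ident \<noteq> happ v" if "v \<in> B" for v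
    using ident_negligible_happ[OF gr[OF that]] negligible_irrefl growing_ident by metis
  define i where "i a = (if a = ident then z else g (inv_into B happ a))" for a
  have i_ident: "i ident = z" and i_happ: "\<And>v. v \<in> B \<Longrightarrow> i (happ v) = g v"
    using inj ident_notin[symmetric] by (auto simp: i_def)
  have g_Field: "g v \<in> Field r" if "v \<in> B" for v
    using zg[OF that] by (auto simp: strict_def Field_def)
  have i_Field: "i a \<in> Field r" if "a \<in> atoms B" for a
    using that z g_Field i_ident i_happ by (auto simp: atoms_def)
  have i_mono: "strict r (i a) (i b)" if ab: "a \<in> atoms B" "b \<in> atoms B" "a \<lless> b" for a b
  proof -
    have "b \<noteq> ident"
    proof
      assume "b = ident"
      then have "b = a \<or> b \<lless> a"
        using ab(1) ident_negligible_happ gr by (auto simp: atoms_def)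
      then show False
        using ab(1,3) grat negligible_irrefl negligible_trans[of a b a] by auto
    qed
    then obtain v where v: "v \<in> B" "b = happ v"
      using ab(2) by (auto simp: atoms_def)
    show ?thesis
    proof (cases "a = ident")
      case True
      then show ?thesis
        using v zg i_ident i_happ by simp
    next
      case False
      then obtain u where "u \<in> B" "a = happ u"
        using ab(1) by (auto simp: atoms_def)
      then show ?thesis
        using v g happ_less ab(3) i_happ by simp
    qed
  qed
  have i_less: "lex_less (strict r) (image_mset i M) (image_mset i N)"
    if "set_mset M \<subseteq> atoms B" "set_mset N \<subseteq> atoms B" "lex_less (\<lless>) M N" for M N
  proof (rule at.lex_less_image[where f = i and Q = "strict r", OF _ _ that])
    show "strict r (i a) (i b)" if "a \<in> atoms B" "b \<in> atoms B" "a \<lless> b" for a b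
      by (rule i_mono[OF that])
    show "\<not> strict r (i b) (i a)" if "a \<in> atoms B" "b \<in> atoms B" "strict r (i a) (i b)" for a b
      using fr.trans[of "i a" "i b" "i a"] fr.irrefl[of "i a"] i_Field that by auto
  qed
  obtain r' where r': "omega_tower r'" and "omega_power r =o r'"
    using omega_tower_power[OF r] .
  then have "omega_power r \<le>o r'"
    using ordIso_iff_ordLeq by blast
  then obtain f where f_Field: "\<And>a. a \<in> Field (omega_power r) \<Longrightarrow> f a \<in> Field r'"
    and f: "\<And>a b. strict (omega_power r) a b \<Longrightarrow> strict r' (f a) (f b)"
    using ordLeq_strict_mono_map by blast
  have "\<exists>M. M \<noteq> {#} \<and> set_mset M \<subseteq> atoms B \<and> s = msum M" if "s \<in> sums (atoms B)" for s
    using that unfolding sums_def by blast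
  then obtain mset_of where mset_of: "\<And>s. s \<in> sums (atoms B) \<Longrightarrow>
      mset_of s \<noteq> {#} \<and> set_mset (mset_of s) \<subseteq> atoms B \<and> s = msum (mset_of s)"
    by metis
  define G where "G s = f (count (image_mset i (mset_of s)))" for s
  have im: "set_mset (image_mset i M) \<subseteq> Field r" if "set_mset M \<subseteq> atoms B" for M
    using that i_Field by auto
  have "f (count {#}) \<in> Field r'"
    by (intro f_Field) (auto simp: Field_omega_power)
  moreover have "strict r' (f (count {#})) (G s)" if "s \<in> sums (atoms B)" for s
  proof -
    have "mset_of s \<noteq> {#}" and sub: "set_mset (mset_of s) \<subseteq> atoms B"
      using mset_of[OF that] by blast+
    then have "lex_less (strict r) {#} (image_mset i (mset_of s))"
      using fr.lex_less_total[of "{#}" "image_mset i (mset_of s)"] im by (auto simp: lex_less_def)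
    then show ?thesis
      unfolding G_def using im[OF sub] by (intro f) (simp add: strict_omega_power)
  qed
  moreover have "strict r' (G s) (G t)" if st: "s \<in> sums (atoms B)" "t \<in> sums (atoms B)" "s \<prec> t" for s t
  proof -
    have sub: "set_mset (mset_of s) \<subseteq> atoms B" "set_mset (mset_of t) \<subseteq> atoms B"
      and eq: "s = msum (mset_of s)" "t = msum (mset_of t)"
      using mset_of st by blast+
    have "\<not> t \<prec> s" "s \<noteq> t"
      using st(3) diverging_gap_trans diverging_gap_irrefl by blast+
    then have "\<not> lex_less (\<lless>) (mset_of t) (mset_of s)" "mset_of s \<noteq> mset_of t"
      using lex_less_imp_diverging_gap[OF at.strict_total_on_axioms grat sub(2,1)] eq by auto
    then have "lex_less (\<lless>) (mset_of s) (mset_of t)"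
      using at.lex_less_total[OF sub] by blast
    then show ?thesis
      unfolding G_def using i_less[OF sub] im sub by (intro f) (simp add: strict_omega_power)
  qed
  ultimately show ?thesis
    unfolding tower_bounded_def using r' by blast
qed

text \<open>
  Allowing multiples of \<open>t\<close> makes the set for \<open>f + g\<close> agree with the one for the larger of \<open>f\<close> and \<open>g\<close>,
  so that addition costs nothing in the induction.
\<close>

definition below :: "(nat \<Rightarrow> nat) \<Rightarrow> (nat \<Rightarrow> nat) set" where
  "below t = {s \<in> terms. \<exists>k. \<forall>\<^sub>F x in sequentially. s x \<le> k * t x}"

lemma dominated_in_below: "s \<in> terms \<Longrightarrow> s \<preceq> t \<Longrightarrow> s \<in> below t"
  unfolding below_def dominated_iff_eventually by (auto intro: exI[of _ 1])

lemma below_subset_if_dominated: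
  assumes "\<forall>\<^sub>F x in sequentially. t x \<le> m * u x"
  shows "below t \<subseteq> below u"
proof
  fix s assume "s \<in> below t"
  then obtain k where s: "s \<in> terms" and k: "\<forall>\<^sub>F x in sequentially. s x \<le> k * t x"
    unfolding below_def by blast
  from assms k have "\<forall>\<^sub>F x in sequentially. s x \<le> (k * m) * u x"
    by eventually_elim (metis mult.assoc mult_le_mono2 order_trans)
  then show "s \<in> below u"
    using s unfolding below_def by blast
qed

lemma summand_not_above:
  assumes M: "a \<in># M" and gr: "growing b" and s: "msum M \<in> below b"
  shows "\<not> b \<lless> a"
proof
  assume "b \<lless> a"
  obtain k where "\<forall>\<^sub>F x in sequentially. msum M x \<le> k * b x"
    using s unfolding below_def by blast
  moreover have "\<forall>\<^sub>F x in sequentially. (k + 1) * b x \<le> a x"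
    using \<open>b \<lless> a\<close> unfolding negligible_def by blast
  moreover note eventually_ge_at_top[of 1]
  ultimately have "\<forall>\<^sub>F x in sequentially. False"
  proof eventually_elim
    case (elim x)
    then have "x \<le> b x"
      using gr by (simp add: growing_def)
    then show ?case
      using elim le_msum[OF M elim(3)] by simp
  qed
  then show False
    by simp
qed

text \<open>
  Every \<open>h \<circ> v\<close> outgrows all multiples of the identity, so only the multiples of the identity remain;
  the value at \<open>1\<close> is the factor, and it is positive.
\<close>

lemma tower_bounded_below_ident: "tower_bounded (below ident)"
proof -
  have lin: "s x = s 1 * x" if "s \<in> below ident" "x \<ge> 1" for s x
  proof -
    have "s \<in> terms"
      using that(1) by (simp add: below_def)
    then obtain M where M: "set_mset M \<subseteq> atoms terms" "s = msum M"
      using terms_eq_sums unfolding sums_def by blast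
    have "a = ident" if "a \<in># M" for a
      using summand_not_above[OF that growing_ident] M \<open>s \<in> below ident\<close> that
        ident_negligible_happ growing_terms by (auto simp: atoms_def)
    then have "M = replicate_mset (size M) ident"
      by (metis set_mset_subset_singletonD singletonI subsetI)
    then have "s y = size M * y" if "y \<ge> 1" for y
      using msum_apply[OF that, of M] that M(2)
      by (metis ident_def image_replicate_mset restrict_apply' atLeast_iff sum_mset_replicate_mset of_nat_id)
    then show ?thesis
      using that(2) by simp
  qed
  have "omega_tower natLeq"
    by (rule omega_tower.omega)
  moreover have "strict natLeq 0 (s 1)" if "s \<in> below ident" for s
    using that growing_terms[of s] by (force simp: below_def growing_def strict_def natLeq_def)
  moreover have "strict natLeq (s 1) (t 1)" if "s \<in> below ident" "t \<in> below ident" "s \<prec> t" for s t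
  proof -
    have "\<forall>\<^sub>F x in sequentially. s x + 1 \<le> t x"
      using that(3) unfolding diverging_gap_def by blast
    then obtain x where "x \<ge> 1" "s x + 1 \<le> t x"
      using eventually_sequentially_ex by blast
    then have "s 1 * x < t 1 * x"
      using lin[OF that(1)] lin[OF that(2)] by (metis Suc_eq_plus1 less_eq_Suc_le)
    then show ?thesis
      by (simp add: strict_def natLeq_def)
  qed
  ultimately show ?thesis
    unfolding tower_bounded_def
    by (intro exI[of _ natLeq] exI[of _ 0] exI[of _ "\<lambda>s. s 1"]) (auto simp: Field_natLeq)
qed

lemma below_happ:
  assumes u: "u \<in> terms"
  shows "below (happ u) \<subseteq> sums (atoms (below u))"
proof
  fix s assume s: "s \<in> below (happ u)"
  then obtain M where M: "M \<noteq> {#}" "set_mset M \<subseteq> atoms terms" "s = msum M"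
    using terms_eq_sums unfolding sums_def below_def by blast
  have "a \<in> atoms (below u)" if a: "a \<in># M" for a
  proof (cases "a = ident")
    case False
    then obtain v where v: "v \<in> terms" "a = happ v"
      using M(2) a by (auto simp: atoms_def)
    have "\<not> happ u \<lless> happ v"
      using summand_not_above[OF a growing_happ] s M(3) v growing_terms u by blast
    then have "v = u \<or> v \<prec> u"
      using happ_negligible_happ growing_terms u v terms_total by blast
    then have "v \<in> below u"
      using v(1) diverging_gap_imp_dominated dominated_in_below
      by (auto simp: eventually_dominated_def)
    then show ?thesis
      using v by (simp add: atoms_def)
  qed (simp add: atoms_def)
  then show "s \<in> sums (atoms (below u))"
    using M unfolding sums_def by blast
qed

lemma tower_bounded_below: "t \<in> terms \<Longrightarrow> tower_bounded (below t)"
proof (induction rule: term_funs.induct)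
  case ident
  then show ?case
    using tower_bounded_below_ident unfolding ident_def .
next
  case (plus f g)
  have sub: "below (\<lambda>x\<in>{1..}. f x + g x) \<subseteq> below u"
    if "f \<preceq> u" "g \<preceq> u" for u
  proof (rule below_subset_if_dominated)
    show "\<forall>\<^sub>F x in sequentially. (\<lambda>x\<in>{1..}. f x + g x) x \<le> 2 * u x"
      using that[unfolded dominated_iff_eventually] eventually_ge_at_top[of 1]
      by eventually_elim simp
  qed
  have refl: "s \<preceq> s" for s
    by (simp add: eventually_dominated_def)
  have "f \<preceq> g \<or> g \<preceq> f"
    using terms_total[OF plus.hyps] diverging_gap_imp_dominated refl by blast
  then show ?case
    using sub plus.IH refl tower_bounded_subset by meson
next
  case (app f)
  have "tower_bounded (sums (atoms (below f)))"
    by (rule tower_bounded_sums_atoms) (use app.IH in \<open>auto simp: below_def\<close>)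
  then have "tower_bounded (below (happ f))"
    using below_happ[OF app.hyps] tower_bounded_subset by blast
  then show ?case
    unfolding happ_def .
qed

lemma initial_segment_in_tower:
  assumes "t \<in> terms"
  obtains r g where "omega_tower r"
    and "\<And>s. \<lbrakk>s \<in> terms; s \<preceq> t\<rbrakk> \<Longrightarrow> g s \<in> Field r"
    and "\<And>s s'. \<lbrakk>s \<in> terms; s' \<in> terms; s \<preceq> t; s' \<preceq> t; s \<prec> s'\<rbrakk> \<Longrightarrow> strict r (g s) (g s')"
proof -
  obtain r z g where rzg: "omega_tower r \<and> z \<in> Field r \<and> (\<forall>s\<in>below t. strict r z (g s)) \<and>
     (\<forall>s\<in>below t. \<forall>s'\<in>below t. s \<prec> s' \<longrightarrow> strict r (g s) (g s'))"
    using tower_bounded_below[OF assms] unfolding tower_bounded_def by (elim exE)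
  then have r: "omega_tower r"
    and zg: "\<And>s. s \<in> below t \<Longrightarrow> strict r z (g s)"
    and g: "\<And>s s'. \<lbrakk>s \<in> below t; s' \<in> below t; s \<prec> s'\<rbrakk> \<Longrightarrow> strict r (g s) (g s')"
    by auto
  show thesis
  proof (rule that[OF r])
    show "g s \<in> Field r" if "s \<in> terms" "s \<preceq> t" for s
      using zg[OF dominated_in_below[OF that]] by (auto simp: strict_def Field_def)
    show "strict r (g s) (g s')"
      if "s \<in> terms" "s' \<in> terms" "s \<preceq> t" "s' \<preceq> t" "s \<prec> s'" for s s'
      using g dominated_in_below that by simp
  qed
qed

text \<open>
  A nonempty set of term functions with a member \<open>t\<close> has a least element as soon as its part up to \<open>t\<close>
  has one, and that part maps into a member of the tower.
\<close>

lemma Well_order_dominance_order: "Well_order (dominance_order terms)"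
proof -
  let ?R = "dominance_order terms"
  have iff: "(s, t) \<in> ?R \<longleftrightarrow> s \<in> terms \<and> t \<in> terms \<and> (s = t \<or> s \<prec> t)" for s t
    using strict_dominance_order[of s t] unfolding strict_def
    by (auto simp: dominance_order_def eventually_dominated_def)
  have "wf (?R - Id)"
  proof (rule wfI_min)
    fix t Q assume "t \<in> (Q :: (nat \<Rightarrow> nat) set)"
    show "\<exists>s\<in>Q. \<forall>y. (y, s) \<in> ?R - Id \<longrightarrow> y \<notin> Q"
    proof (cases "t \<in> terms")
      case False
      then show ?thesis
        using \<open>t \<in> Q\<close> iff by blast
    next
      case True
      then obtain r g where r: "omega_tower r"
        and g: "\<And>s s'. \<lbrakk>s \<in> terms; s' \<in> terms; s \<preceq> t; s' \<preceq> t; s \<prec> s'\<rbrakk> \<Longrightarrow> strict r (g s) (g s')"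
        using initial_segment_in_tower[OF True] by metis
      have "wf (r - Id)"
        using omega_tower_Well_order[OF r] by (simp add: well_order_on_def)
      then have wf: "wf (inv_image (r - Id) g)"
        by (rule wf_inv_image)
      let ?S = "{s \<in> Q. (s, t) \<in> ?R}"
      have "t \<in> ?S"
        using \<open>t \<in> Q\<close> True iff by blast
      with wf have "\<exists>s\<in>?S. \<forall>y. (y, s) \<in> inv_image (r - Id) g \<longrightarrow> y \<notin> ?S"
        unfolding wf_eq_minimal by (elim allE impE)
      then obtain s where s: "s \<in> Q" "(s, t) \<in> ?R"
        and min: "\<And>y. (y, s) \<in> inv_image (r - Id) g \<Longrightarrow> y \<notin> ?S"
        by auto
      have "y \<notin> Q" if y: "(y, s) \<in> ?R - Id" for y
      proof
        assume "y \<in> Q"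
        have ys: "y \<in> terms" "s \<in> terms" "y \<prec> s"
          using y iff by auto
        have yt: "(y, t) \<in> ?R"
          using ys(3) s(2) y iff diverging_gap_trans by auto
        then have "strict r (g y) (g s)"
          using g ys s(2) by (simp add: dominance_order_def)
        then show False
          using min[of y] yt \<open>y \<in> Q\<close> by (simp add: strict_def)
      qed
      then show ?thesis
        using s(1) by blast
    qed
  qed
  moreover have "trans ?R"
    by (rule transI) (auto simp: iff intro: diverging_gap_trans)
  moreover have "antisym ?R"
    by (rule antisymI) (auto simp: iff diverging_gap_irrefl dest: diverging_gap_trans)
  moreover have "refl_on terms ?R" "total_on terms ?R" "?R \<subseteq> terms \<times> terms"
    using terms_total by (auto simp: iff refl_on_def total_on_def)
  ultimately show ?thesis
    by (simp add: order_on_defs Field_dominance_order)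
qed

section \<open>The order type\<close>

text \<open>
  The base of the tower embeds through the multiples of the identity. At a power, the map on multisets
  described at the outset is shifted by the identity, because the empty sum is not a term function.
\<close>

lemma omega_tower_ordLeq: "omega_tower r \<Longrightarrow> r \<le>o dominance_order terms"
proof (induction rule: omega_tower.induct)
  case omega
  have in_terms: "msum (replicate_mset (Suc n) ident) \<in> terms" for n
    by (subst terms_eq_sums) (rule msum_in_sums, auto simp: atoms_def split: if_splits)
  show ?case
  proof (rule ordLeq_if_strict_mono[OF natLeq_Well_order Well_order_dominance_order])
    fix m n :: nat assume "strict natLeq m n"
    then have "m < n"
      by (auto simp: strict_def natLeq_def)
    then have "lex_less (\<lless>) (replicate_mset (Suc m) ident) (replicate_mset (Suc n) ident)"
      using negligible_irrefl[OF growing_ident] unfolding lex_less_def by (intro exI[of _ ident]) auto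
    then have "msum (replicate_mset (Suc m) ident) \<prec> msum (replicate_mset (Suc n) ident)"
      by (intro lex_less_imp_diverging_gap[OF strict_total_on_atoms_terms growing_atoms_terms])
        (auto simp: atoms_def split: if_splits)
    then show "strict (dominance_order terms) (msum (replicate_mset (Suc m) ident)) (msum (replicate_mset (Suc n) ident))"
      using in_terms by (simp only: strict_dominance_order)
  qed (use in_terms in \<open>simp only: Field_dominance_order\<close>)
next
  case (power r s)
  have wr: "Well_order r"
    by (rule omega_tower_Well_order[OF power.hyps(1)])
  interpret fr: strict_total_on "Field r" "strict r"
    by (rule strict_total_on_Field[OF wr])
  obtain f where f: "\<And>a. a \<in> Field r \<Longrightarrow> f a \<in> terms"
    and f_mono: "\<And>a b. strict r a b \<Longrightarrow> f a \<prec> f b"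
    using ordLeq_strict_mono_map[OF power.IH] unfolding Field_dominance_order strict_dominance_order
    by metis
  define G where "G \<phi> = add_mset ident (image_mset (happ \<circ> f) (Abs_multiset \<phi>))" for \<phi>
  have G_count: "G (count M) = add_mset ident (image_mset (happ \<circ> f) M)" for M
    by (simp add: G_def count_inverse)
  have G_atoms: "set_mset (G (count M)) \<subseteq> atoms terms" if "set_mset M \<subseteq> Field r" for M
    using that f by (auto simp: G_count atoms_def)
  have G_terms: "msum (G \<phi>) \<in> terms" if "\<phi> \<in> Field (omega_power r)" for \<phi>
  proof -
    obtain M where "set_mset M \<subseteq> Field r" "\<phi> = count M"
      using \<open>\<phi> \<in> Field (omega_power r)\<close> by (auto simp: Field_omega_power)
    then have "set_mset (G \<phi>) \<subseteq> atoms terms" "G \<phi> \<noteq> {#}"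
      using G_atoms by (auto simp: G_def)
    then show ?thesis
      using terms_eq_sums unfolding sums_def by blast
  qed
  have G_mono: "msum (G \<phi>) \<prec> msum (G \<psi>)" if less: "strict (omega_power r) \<phi> \<psi>" for \<phi> \<psi>
  proof -
    have "\<phi> \<in> Field (omega_power r)" "\<psi> \<in> Field (omega_power r)"
      using less by (auto simp: strict_def Field_def)
    then obtain M N where eq: "\<phi> = count M" "\<psi> = count N"
      by (auto simp: Field_omega_power)
    then have M: "set_mset M \<subseteq> Field r" "set_mset N \<subseteq> Field r" "lex_less (strict r) M N"
      using less by (simp_all add: strict_omega_power)
    have "lex_less (\<lless>) (image_mset (happ \<circ> f) M) (image_mset (happ \<circ> f) N)"
    proof (rule fr.lex_less_image[OF _ _ M])
      show "(happ \<circ> f) a \<lless> (happ \<circ> f) b" if "a \<in> Field r" "strict r a b" for a b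
        using that f f_mono growing_terms by (auto intro: happ_negligible_happ)
      show "\<not> (happ \<circ> f) b \<lless> (happ \<circ> f) a"
        if "a \<in> Field r" "(happ \<circ> f) a \<lless> (happ \<circ> f) b" for a b
        using negligible_irrefl[OF growing_happ[OF growing_terms[OF f[OF that(1)]]]]
          negligible_trans[OF that(2)] by auto
    qed
    then have "lex_less (\<lless>) (G \<phi>) (G \<psi>)"
      unfolding eq G_count by (rule lex_less_add_mset)
    then show ?thesis
      using G_atoms M(1,2) unfolding eq
      by (intro lex_less_imp_diverging_gap[OF strict_total_on_atoms_terms growing_atoms_terms])
  qed
  have "omega_power r \<le>o dominance_order terms"
  proof (rule ordLeq_if_strict_mono[OF Well_order_omega_power[OF wr] Well_order_dominance_order])
    show "msum (G \<phi>) \<in> Field (dominance_order terms)" if "\<phi> \<in> Field (omega_power r)" for \<phi>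
      using G_terms[OF that] by (simp only: Field_dominance_order)
    show "strict (dominance_order terms) (msum (G \<phi>)) (msum (G \<psi>))"
      if "strict (omega_power r) \<phi> \<psi>" for \<phi> \<psi>
    proof -
      have "\<phi> \<in> Field (omega_power r)" "\<psi> \<in> Field (omega_power r)"
        using that by (auto simp: strict_def Field_def)
      then show ?thesis
        using G_terms G_mono[OF that] by (simp add: strict_dominance_order)
    qed
  qed
  then show ?case
    using power.hyps(2) ordIso_ordLeq_trans by blast
qed

text \<open>
  A well-order \<open>e'\<close> shorter than the dominance order is isomorphic to the functions strictly below some
  \<open>t\<close>. Those map strictly below \<open>g t\<close> in a member \<open>r\<close> of the tower, so \<open>e'\<close> is shorter than \<open>r\<close> and
  cannot bound the tower.
\<close>

theorem dominance_order_epsilon0: "has_order_type_epsilon0 (dominance_order terms)"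
  unfolding has_order_type_epsilon0_def
proof (intro conjI allI impI)
  let ?R = "dominance_order terms"
  fix e' :: "(nat \<Rightarrow> nat) rel"
  assume e': "Well_order e' \<and> (\<forall>r. omega_tower r \<longrightarrow> r \<le>o e')"
  show "?R \<le>o e'"
  proof (rule ccontr)
    assume "\<not> ?R \<le>o e'"
    then have "e' <o ?R"
      using e' Well_order_dominance_order not_ordLeq_iff_ordLess by blast
    then obtain t where t: "t \<in> terms" and seg: "e' =o Restr ?R (underS ?R t)"
      using ordLess_iff_ordIso_Restr[OF Well_order_dominance_order] e' Field_dominance_order by blast
    obtain r g where r: "omega_tower r"
      and g_Field: "\<And>s. \<lbrakk>s \<in> terms; s \<preceq> t\<rbrakk> \<Longrightarrow> g s \<in> Field r"
      and g: "\<And>s s'. \<lbrakk>s \<in> terms; s' \<in> terms; s \<preceq> t; s' \<preceq> t; s \<prec> s'\<rbrakk> \<Longrightarrow> strict r (g s) (g s')"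
      using initial_segment_in_tower[OF t] by metis
    have wr: "Well_order r"
      by (rule omega_tower_Well_order[OF r])
    have refl: "s \<preceq> s" for s
      by (simp add: eventually_dominated_def)
    have underS: "s \<in> underS ?R t \<longleftrightarrow> s \<in> terms \<and> s \<prec> t" for s
      using strict_dominance_order[of s t] t by (auto simp: underS_def strict_def)
    have gt: "g t \<in> Field r"
      by (rule g_Field[OF t refl])
    have into: "g s \<in> underS r (g t)" if "s \<in> underS ?R t" for s
      using that underS g[of s t] t refl diverging_gap_imp_dominated by (auto simp: underS_def strict_def)
    have "Restr ?R (underS ?R t) \<le>o Restr r (underS r (g t))"
    proof (rule ordLeq_if_strict_mono[OF Well_order_Restr Well_order_Restr])
      show "g s \<in> Field (Restr r (underS r (g t)))" if "s \<in> Field (Restr ?R (underS ?R t))" for s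
      proof -
        have "s \<in> underS ?R t"
          using that Field_Restr_subset by (rule subsetD[rotated])
        moreover have "Field (Restr r (underS r (g t))) = underS r (g t)"
          using wr by (simp add: Field_Restr_ofilter wo_rel.underS_ofilter wo_rel_def)
        ultimately show ?thesis
          using into by simp
      qed
      show "strict (Restr r (underS r (g t))) (g s) (g s')"
        if "strict (Restr ?R (underS ?R t)) s s'" for s s'
      proof -
        have s: "s \<in> underS ?R t" "s' \<in> underS ?R t" "strict ?R s s'"
          using that by (auto simp: strict_def)
        then have "strict r (g s) (g s')"
          using g[of s s'] underS diverging_gap_imp_dominated strict_dominance_order[of s s'] by auto
        then show ?thesis
          using into s by (auto simp: strict_def)
      qed
    qed (fact Well_order_dominance_order wr)+
    then have "e' \<le>o Restr r (underS r (g t))"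
      using seg ordIso_ordLeq_trans by blast
    also have "Restr r (underS r (g t)) <o r"
      by (rule underS_Restr_ordLess[OF wr]) (use gt in blast)
    also have "r \<le>o e'"
      using e' r by blast
    finally show False
      using ordLess_irreflexive by blast
  qed
qed (use Well_order_dominance_order omega_tower_ordLeq in blast)+

end

interpretation factorial: rapid_growth fact
proof
  show "mono (fact :: nat \<Rightarrow> nat)"
    by (simp add: mono_def fact_mono)
  show "n \<le> fact n" for n
    by (rule fact_ge_self)
  show "\<exists>m. \<forall>\<^sub>F n in sequentially. k * fact n \<le> (fact (n + m) :: nat)" for k
  proof (intro exI)
    show "\<forall>\<^sub>F n in sequentially. k * fact n \<le> (fact (n + 1) :: nat)"
      using eventually_ge_at_top[of k]
      by eventually_elim (simp add: trans_le_add2)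
  qed
qed

interpretation power_of_two: rapid_growth "\<lambda>n. 2 ^ n"
proof
  show "mono (\<lambda>n. 2 ^ n :: nat)"
    by (simp add: mono_def)
  show "n \<le> 2 ^ n" for n :: nat
    by (simp add: less_imp_le)
  show "\<exists>m. \<forall>\<^sub>F n in sequentially. k * 2 ^ n \<le> (2 ^ (n + m) :: nat)" for k
    by (intro exI[of _ k]) (simp add: power_add less_imp_le)
qed

theorem theorem3p15:
  shows "has_order_type_epsilon0 (dominance_order plus_fact_terms) \<and>
         has_order_type_epsilon0 (dominance_order plus_exp2_terms)"
  unfolding plus_fact_terms_def plus_exp2_terms_def
  using factorial.dominance_order_epsilon0 power_of_two.dominance_order_epsilon0 by blast

end
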